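(* Let $\lambda,x,y$ be indeterminates, and let $\{Q_n\}_{n\ge 0}$ be the sequence of polynomials in $\lambda,x,y$ defined by $Q_0=1$ and, for $n\ge 1$, $$Q_n=\binom{\lambda}{n}(-1)^n-x\sum_{k=1}^n(-1)^k\binom{y}{k}Q_{n-k}.$$ Then the generating function $Q(\tau)=\sum_{n=0}^\infty Q_n\tau^n$ is given, as a formal power series in $\tau$, by $$Q(\tau)=\frac{(1-\tau)^{\lambda}}{1-x+x(1-\tau)^{y}}.$$
   Context: For an indeterminate $u$ and integer $n\ge 0$, $\binom{u}{n}=\frac{u(u-1)\cdots(u-n+1)}{n!}$ (equal to $1$ for $n=0$). For an indeterminate $u$, $(1-\tau)^u$ denotes the formal binomial series $\sum_{n\ge 0}\binom{u}{n}(-\tau)^n$. The denominator $1-x+x(1-\tau)^y$ is a formal power series in $\tau$ with constant term $1$, hence invertible. *)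

theory Defs
  imports "HOL-Computational_Algebra.Computational_Algebra"
begin

(* The polynomial ring K[lambda, x, y] over a field K of characteristic 0 is the
   iterated polynomial ring K[lambda][x][y], i.e. the type 'k poly poly poly. *)

definition lambda_var :: "'k::field_char_0 poly poly poly"
  where "lambda_var = [:[:[:0, 1:]:]:]"

definition x_var :: "'k::field_char_0 poly poly poly"
  where "x_var = [:[:0, 1:]:]"

definition y_var :: "'k::field_char_0 poly poly poly"
  where "y_var = [:0, 1:]"

lemma is_unit_fact_poly3:
  "is_unit (fact n :: 'k::field_char_0 poly poly poly)"
proof -
  have "(of_nat m :: 'k poly poly poly) = [:[:[:of_nat m:]:]:]" for m
    by (simp only: of_nat_poly)
  from this[of "fact n"] have "(fact n :: 'k poly poly poly) = [:[:[:fact n:]:]:]"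
    by (simp only: of_nat_fact)
  then have "(1 :: 'k poly poly poly) = fact n * [:[:[:inverse (fact n):]:]:]"
    by (simp add: one_pCons)
  then show ?thesis
    by (rule dvdI)
qed

(* Same formula as the library's gbinomial, which the parser accepts only over fields.
   The division is that of an integral domain; in K[lambda, x, y] it is always exact,
   because n! is a unit there. *)
definition binom :: "'r::{idom_divide,ring_char_0} \<Rightarrow> nat \<Rightarrow> 'r"
  where "binom u n = (\<Prod>i = 0..<n. u - of_nat i) div fact n"

lemma binom_eq_gbinomial: "binom (u :: 'k::field_char_0) n = u gchoose n"
  by (simp add: binom_def gbinomial_prod_rev)

lemma binom_mult_fact:
  fixes u :: "'k::field_char_0 poly poly poly"
  shows "fact n * binom u n = (\<Prod>i = 0..<n. u - of_nat i)"
  unfolding binom_def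
  by (rule dvd_mult_div_cancel) (rule unit_imp_dvd[OF is_unit_fact_poly3])

definition one_minus_tau_pow :: "'r::{idom_divide,ring_char_0} \<Rightarrow> 'r fps"
  where "one_minus_tau_pow u = Abs_fps (\<lambda>n. binom u n * (-1) ^ n)"

(* The library's division of power series needs an inverse operation on the coefficients,
   which polynomials lack. This is the quotient f / g for g with constant term 1. *)
definition fps_quot :: "'r::comm_ring_1 fps \<Rightarrow> 'r fps \<Rightarrow> 'r fps"
  where "fps_quot f g = f * fps_right_inverse g 1"

lemma fps_quot_mult:
  fixes f g :: "'r::comm_ring_1 fps"
  assumes "fps_nth g 0 = 1"
  shows "fps_quot f g * g = f"
proof -
  have "g * fps_right_inverse g 1 = 1"
    using assms by (intro fps_right_inverse) simp
  then have "f * (g * fps_right_inverse g 1) = f"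
    by (simp only: mult_1_right)
  then show ?thesis
    by (simp only: fps_quot_def mult.assoc mult.commute[of "fps_right_inverse g 1"])
qed

lemma denominator_nth_0:
  "fps_nth (1 - fps_const x + fps_const x * one_minus_tau_pow y) 0 = 1"
  by (simp add: one_minus_tau_pow_def binom_def)

end

theory Submission
  imports Defs
begin

text \<open>
  The recursion is a coefficient comparison in disguise. Since the series \<open>(1 - \<tau>)\<^sup>y\<close> has
  constant term 1, the denominator \<open>D = 1 - x + x (1 - \<tau>)\<^sup>y\<close> has constant term 1 and, for
  \<open>k \<ge> 1\<close>, the coefficient \<open>x (-1)\<^sup>k binom y k\<close> at \<open>\<tau>\<^sup>k\<close>. Moving the sum in the recursion to
  the left-hand side therefore leaves the \<open>n\<close>-th coefficient of \<open>D Q(\<tau>)\<close> on the left and that of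
  \<open>(1 - \<tau>)\<^sup>\<lambda>\<close> on the right (\<open>denominator_mult_generating_function\<close>). As \<open>D\<close> is invertible, this
  product identity determines \<open>Q(\<tau>)\<close> (\<open>fps_quot_eqI\<close>).
\<close>

lemma fps_quot_eqI:
  fixes f g h :: "'r::comm_ring_1 fps"
  assumes "fps_nth g 0 = 1" and "g * h = f"
  shows "h = fps_quot f g"
proof -
  have "g * fps_right_inverse g 1 = 1"
    using assms(1) by (intro fps_right_inverse) simp
  then have "h = h * (g * fps_right_inverse g 1)"
    by simp
  also have "\<dots> = fps_quot f g"
    by (simp add: fps_quot_def assms(2)[symmetric] ac_simps)
  finally show ?thesis .
qed

lemma denominator_nth:
  assumes "k \<ge> 1"
  shows "fps_nth (1 - fps_const x + fps_const x * one_minus_tau_pow y) k =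
    x * ((-1) ^ k * binom y k)"
  using assms by (simp add: one_minus_tau_pow_def mult.commute)

lemma denominator_mult_generating_function:
  fixes Q :: "nat \<Rightarrow> 'r::{idom_divide,ring_char_0}"
  assumes Q_0: "Q 0 = 1"
    and Q_rec: "\<And>n. n \<ge> 1 \<Longrightarrow>
      Q n = binom l n * (-1) ^ n - x * (\<Sum>k = 1..n. (-1) ^ k * binom y k * Q (n - k))"
  shows "(1 - fps_const x + fps_const x * one_minus_tau_pow y) * Abs_fps Q = one_minus_tau_pow l"
    (is "?D * _ = _")
proof (rule fps_ext)
  fix n
  show "fps_nth (?D * Abs_fps Q) n = fps_nth (one_minus_tau_pow l) n"
  proof (cases "n = 0")
    case True
    then show ?thesis
      by (simp add: Q_0 one_minus_tau_pow_def binom_def)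
  next
    case False
    \<comment> \<open>The constant term of the denominator is not given by the formula for \<open>k \<ge> 1\<close>, which would
      yield \<open>x\<close>; splitting off that summand isolates \<open>Q n\<close>.\<close>
    have "fps_nth (?D * Abs_fps Q) n = (\<Sum>k = 0..n. fps_nth ?D k * Q (n - k))"
      by (simp add: fps_mult_nth)
    also have "\<dots> = fps_nth ?D 0 * Q n + (\<Sum>k = 1..n. fps_nth ?D k * Q (n - k))"
      by (simp add: sum.atLeast_Suc_atMost)
    also have "\<dots> = Q n + (\<Sum>k = 1..n. x * ((-1) ^ k * binom y k) * Q (n - k))"
      by (simp only: denominator_nth_0 mult_1_left)
        (intro arg_cong2[where f = "(+)"] sum.cong refl, simp only: denominator_nth atLeastAtMost_iff)
    also have "\<dots> = Q n + x * (\<Sum>k = 1..n. (-1) ^ k * binom y k * Q (n - k))"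
      by (simp only: sum_distrib_left mult.assoc)
    also have "\<dots> = binom l n * (-1) ^ n"
      using Q_rec[of n] False by simp
    finally show ?thesis
      by (simp add: one_minus_tau_pow_def)
  qed
qed

theorem lemma1:
  fixes Q :: "nat \<Rightarrow> 'k::field_char_0 poly poly poly"
  assumes Q_0: "Q 0 = 1"
    and Q_rec: "\<And>n. n \<ge> 1 \<Longrightarrow>
      Q n = binom lambda_var n * (-1) ^ n
        - x_var * (\<Sum>k = 1..n. (-1) ^ k * binom y_var k * Q (n - k))"
  shows "Abs_fps Q =
    fps_quot (one_minus_tau_pow lambda_var)
      (1 - fps_const x_var + fps_const x_var * one_minus_tau_pow y_var)"
  by (intro fps_quot_eqI denominator_nth_0 denominator_mult_generating_function Q_0 Q_rec)

end
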